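(* For $\alpha>0$ let $$M_\alpha(x,y)=\int_{-\infty}^\infty\frac{e^{\alpha\lambda}}{e^{\alpha\lambda}+1}\,\mathrm{Ai}(x+\lambda)\,\mathrm{Ai}(y+\lambda)\,d\lambda .$$ Then for all real $u,v$, $$\lim_{\alpha\to0+}\frac1\alpha M_\alpha\Big(\frac u\alpha-\frac1{2\alpha}\log(4\pi\alpha^3),\ \frac v\alpha-\frac1{2\alpha}\log(4\pi\alpha^3)\Big)=K_{\mathrm{ext}}(u,v)$$ and $$\lim_{\alpha\to\infty}M_\alpha(u,v)=K_{\mathrm{Airy}}(u,v).$$
   Context: $\mathrm{Ai}$ is the Airy function. $K_{\mathrm{ext}}(u,v)=e^{-u}$ if $u=v$ and $K_{\mathrm{ext}}(u,v)=0$ if $u\ne v$. $K_{\mathrm{Airy}}(u,v)=\int_0^\infty\mathrm{Ai}(u+\lambda)\mathrm{Ai}(v+\lambda)\,d\lambda$ is the Airy kernel. *)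

theory Defs
  imports "HOL-Analysis.Analysis"
begin

text \<open>
  The Airy function of a real argument, given by its classical representation as a
  (conditionally convergent) improper integral.
\<close>
definition Ai :: "real \<Rightarrow> real" where
  "Ai x = 1 / pi * Lim at_top (\<lambda>R. integral {0..R} (\<lambda>t. cos (t ^ 3 / 3 + x * t)))"

definition M_kernel :: "real \<Rightarrow> real \<Rightarrow> real \<Rightarrow> real" where
  "M_kernel \<alpha> x y =
     (LINT l|lborel. exp (\<alpha> * l) / (exp (\<alpha> * l) + 1) * Ai (x + l) * Ai (y + l))"

definition K_ext :: "real \<Rightarrow> real \<Rightarrow> real" where
  "K_ext u v = (if u = v then exp (- u) else 0)"

definition K_Airy :: "real \<Rightarrow> real \<Rightarrow> real" where
  "K_Airy u v = (LINT l:{0..}|lborel. Ai (u + l) * Ai (v + l))"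

end

theory Submission
  imports Defs
    "HOL-Probability.Characteristic_Functions"
    "HOL-Complex_Analysis.Complex_Analysis"
    "HOL-Real_Asymp.Real_Asymp"
begin

text \<open>
  Shifting the contour to the line \<open>Re z = c > 0\<close> exhibits \<open>exp (c x) Ai x\<close> as the Fourier transform
  of the Gaussian-like function \<open>s \<mapsto> exp ((c + i s)\<^sup>3 / 3)\<close>. This bounds \<open>Ai x\<close> by a multiple of
  \<open>exp (- c x)\<close> for every \<open>c > 0\<close>, and with Fourier inversion and Parseval's formula it gives
  \<open>\<integral> exp (a l) Ai (x + l) Ai (y + l) dl = exp (a\<^sup>3/12 - a (x + y)/2 - (x - y)\<^sup>2/(4 a)) / sqrt (4 \<pi> a)\<close>.
  As \<open>\<alpha>\<close> tends to 0, the Fermi factor may be replaced by \<open>exp (\<alpha> l)\<close>, and the rescaling turns the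
  formula into \<open>exp (\<alpha>\<^sup>3/12 - (u + v)/2 - (u - v)\<^sup>2/(4 \<alpha>\<^sup>3))\<close>. The limit at infinity is dominated
  convergence, since the Fermi factor is at most \<open>exp l\<close> for \<open>\<alpha> \<ge> 1\<close>.
\<close>

section \<open>Fourier transform on the real line\<close>

text \<open>Angular-frequency convention without a prefactor, so that applying the transform twice
  gives \<open>2 * pi\<close> times the reflected function.\<close>

definition fourier :: "(real \<Rightarrow> complex) \<Rightarrow> real \<Rightarrow> complex" where
  "fourier f y = (LINT x|lborel. f x * cis (- (x * y)))"

lemma borel_measurable_cis [measurable (raw)]:
  "f \<in> borel_measurable M \<Longrightarrow> (\<lambda>x. cis (f x)) \<in> borel_measurable M"
  by (intro measurable_compose[of f M borel cis] borel_measurable_continuous_onI continuous_intros)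

text \<open>Both sides are iterated forms of one double integral, and Fubini applies since the
  modulus of the integrand splits as \<open>norm (f x) * norm (g y)\<close>. It serves twice: for
  inversion, and as Parseval's formula for the Airy products.\<close>

lemma fourier_multiplication_formula:
  assumes "integrable lborel f" "integrable lborel g"
  shows "(LINT x|lborel. f x * fourier g x) = (LINT y|lborel. fourier f y * g y)"
proof -
  have [measurable]: "f \<in> borel_measurable borel" "g \<in> borel_measurable borel"
    using assms by (auto dest: borel_measurable_integrable)
  have *: "integrable (lborel \<Otimes>\<^sub>M lborel) (\<lambda>(x, y). f x * (g y * cis (- (y * x))))"
  proof (rule lborel_pair.Fubini_integrable)
    have "(LINT y|lborel. norm (f x * (g y * cis (- (y * x))))) = norm (f x) * (LINT y|lborel. norm (g y))" for x
      by (simp add: norm_mult)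
    then show "integrable lborel (\<lambda>x. LINT y|lborel. norm (case (x, y) of (x, y) \<Rightarrow> f x * (g y * cis (- (y * x)))))"
      using assms(1) by simp
    have "integrable lborel (\<lambda>y. f x * (g y * cis (- (y * x))))" for x
      by (rule Bochner_Integration.integrable_bound[of _ "\<lambda>y. f x * g y"]) (use assms in \<open>auto simp: norm_mult\<close>)
    then show "AE x in lborel. integrable lborel (\<lambda>y. case (x, y) of (x, y) \<Rightarrow> f x * (g y * cis (- (y * x))))"
      by simp
  qed measurable
  have "(LINT x|lborel. f x * fourier g x) = (LINT x|lborel. LINT y|lborel. f x * (g y * cis (- (y * x))))"
    by (simp add: fourier_def)
  also have "\<dots> = (LINT y|lborel. LINT x|lborel. f x * (g y * cis (- (y * x))))"
    using lborel_pair.Fubini_integral[OF *] by simp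
  also have "\<dots> = (LINT y|lborel. LINT x|lborel. f x * cis (- (x * y)) * g y)"
    by (simp add: mult_ac)
  also have "\<dots> = (LINT y|lborel. fourier f y * g y)"
    by (simp add: fourier_def)
  finally show ?thesis .
qed

text \<open>Both claims are rescalings of facts about the standard normal law: integrability of its
  density and its characteristic function.\<close>

lemma fourier_gaussian:
  assumes "c > 0"
  shows "integrable lborel (\<lambda>x::real. exp (- c * x\<^sup>2))"
    and "fourier (\<lambda>x. of_real (exp (- c * x\<^sup>2))) y = of_real (sqrt (pi / c) * exp (- y\<^sup>2 / (4 * c)))"
proof -
  \<comment> \<open>This scale makes \<open>(k * x)\<^sup>2 / 2\<close> equal to
    \<open>c * x\<^sup>2\<close>.\<close>
  define k where "k = sqrt (2 * c)"
  have k: "k > 0" "k\<^sup>2 = 2 * c" using assms by (auto simp: k_def)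
  have "integrable lborel (\<lambda>x. std_normal_density x)"
    using integrable_std_normal_moment[of 0] by simp
  from lborel_integrable_real_affine[OF this, of k 0] k(1)
  have "integrable lborel (\<lambda>x. std_normal_density (k * x))" by simp
  from integrable_mult_right[OF this, of "sqrt (2 * pi)"]
  show "integrable lborel (\<lambda>x::real. exp (- c * x\<^sup>2))"
    by (simp add: std_normal_density_def power_mult_distrib k)
  have "of_real (exp (- (t\<^sup>2) / 2)) = (LINT x|lborel. std_normal_density x *\<^sub>R cis (t * x))" for t
    using fun_cong[OF char_std_normal_distribution, of t] 
    by (subst (asm) char_def, subst (asm) integral_density) (auto simp: cis_conv_exp normal_density_nonneg)
  \<comment> \<open>At this frequency the substitution of \<open>k * x\<close> for \<open>x\<close>
    turns the phase into \<open>- (x * y)\<close>.\<close>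
  from this[of "- y / k"] have "of_real (exp (- ((- y / k)\<^sup>2) / 2)) = 
     (LINT x|lborel. std_normal_density x *\<^sub>R cis (- y / k * x))" .
  also have "\<dots> = k *\<^sub>R (LINT x|lborel. std_normal_density (k * x) *\<^sub>R cis (- y / k * (k * x)))"
    using k(1) lborel_integral_real_affine[of k "\<lambda>x. std_normal_density x *\<^sub>R cis (- y / k * x)" 0] by simp
  also have "(\<lambda>x. std_normal_density (k * x) *\<^sub>R cis (- y / k * (k * x))) = 
      (\<lambda>x. of_real (1 / sqrt (2 * pi)) * (of_real (exp (- c * x\<^sup>2)) * cis (- (x * y))))"
    using k(1) less_imp_neq[OF k(1)] by (auto simp: std_normal_density_def power_mult_distrib k scaleR_conv_of_real mult_ac)
  finally have "of_real (exp (- ((- y / k)\<^sup>2) / 2)) = of_real (k / sqrt (2 * pi)) * fourier (\<lambda>x. of_real (exp (- c * x\<^sup>2))) y"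
    by (simp add: fourier_def scaleR_conv_of_real)
  then have "fourier (\<lambda>x. of_real (exp (- c * x\<^sup>2))) y = of_real (sqrt (2 * pi) / k * exp (- ((- y / k)\<^sup>2) / 2))"
    using k(1) by (simp add: field_simps)
  also have "sqrt (2 * pi) / k = sqrt (pi / c)" using assms by (simp add: k_def real_sqrt_divide real_sqrt_mult)
  also have "- ((- y / k)\<^sup>2) / 2 = - y\<^sup>2 / (4 * c)" by (simp add: power_divide k)
  finally show "fourier (\<lambda>x. of_real (exp (- c * x\<^sup>2))) y = of_real (sqrt (pi / c) * exp (- y\<^sup>2 / (4 * c)))" .
qed

lemma fourier_modulation: "fourier (\<lambda>x. f x * cis (t * x)) y = fourier f (y - t)"
  by (simp add: fourier_def mult.assoc cis_mult algebra_simps)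

lemma norm_fourier_le: "norm (fourier f y) \<le> (LINT x|lborel. norm (f x))"
  unfolding fourier_def by (rule integral_norm_bound[THEN order_trans]) (simp add: norm_mult)

lemma continuous_on_fourier:
  assumes "integrable lborel f"
  shows "continuous_on UNIV (fourier f)"
  unfolding continuous_on_sequentially o_def fourier_def
proof safe
  fix X :: "nat \<Rightarrow> real" and y assume "X \<longlonglongrightarrow> y"
  have [measurable]: "f \<in> borel_measurable borel" using assms by auto
  show "(\<lambda>n. LINT x|lborel. f x * cis (- (x * X n))) \<longlonglongrightarrow> (LINT x|lborel. f x * cis (- (x * y)))"
    by (rule integral_dominated_convergence[where w="\<lambda>x. norm (f x)"])
       (use assms \<open>X \<longlonglongrightarrow> y\<close> in \<open>auto simp: norm_mult intro!: tendsto_intros\<close>)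
qed

text \<open>The multiplication formula is applied to \<open>fourier f\<close> damped by a modulated Gaussian, whose
  transform is an approximate identity at \<open>- y\<close>.\<close>

lemma fourier_inversion:
  fixes f :: "real \<Rightarrow> complex"
  assumes "integrable lborel f" "integrable lborel (fourier f)"
    and cont: "continuous_on UNIV f" and bound: "\<And>x. norm (f x) \<le> B"
  shows "fourier (fourier f) y = 2 * pi * f (- y)"
proof -
  have [measurable]: "f \<in> borel_measurable borel" "fourier f \<in> borel_measurable borel"
    using assms by auto
  define r :: "nat \<Rightarrow> real" where "r n = 1 / Suc n" for n
  have r: "r n > 0" "r n \<noteq> 0" for n by (auto simp: r_def)
  have r0: "r \<longlonglongrightarrow> 0" unfolding r_def by (rule LIMSEQ_Suc[OF lim_1_over_n])
  have eq: "(LINT x|lborel. fourier f x * (of_real (exp (- ((r n)\<^sup>2 / 2) * x\<^sup>2)) * cis (- y * x))) =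
     of_real (sqrt (2 * pi)) * (LINT w|lborel. of_real (exp (- (w\<^sup>2 / 2))) * f (- y + r n * w))" (is "?L = _") for n
  proof -
    \<comment> \<open>The transformed Gaussian is then centred at \<open>- y\<close> with standard
      deviation \<open>r n\<close>, and putting \<open>s = - y + r n * w\<close> moves all
      dependence on \<open>n\<close> into the argument of \<open>f\<close>.\<close>
    define c where "c = (r n)\<^sup>2 / 2"
    have c: "c > 0" using r[of n] by (simp add: c_def)
    have int: "integrable lborel (\<lambda>x::real. of_real (exp (- c * x\<^sup>2)) :: complex)"
      by (intro integrable_of_real fourier_gaussian(1) c)
    have int': "integrable lborel (\<lambda>x::real. of_real (exp (- c * x\<^sup>2)) * cis (- y * x))"
      by (rule Bochner_Integration.integrable_bound[OF int]) (auto simp: norm_mult)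
    have "?L = (LINT x|lborel. (of_real (exp (- c * x\<^sup>2)) * cis (- y * x)) * fourier f x)"
      by (simp add: c_def mult_ac)
    also have "\<dots> = (LINT s|lborel. fourier (\<lambda>x. of_real (exp (- c * x\<^sup>2)) * cis (- y * x)) s * f s)"
      by (rule fourier_multiplication_formula[OF int' assms(1)])
    also have "\<dots> = (LINT s|lborel. of_real (sqrt (pi / c) * exp (- (s + y)\<^sup>2 / (4 * c))) * f s)"
      unfolding fourier_modulation fourier_gaussian(2)[OF c] by simp
    also have "\<dots> = r n *\<^sub>R (LINT w|lborel. of_real (sqrt (pi / c) * exp (- (r n * w)\<^sup>2 / (4 * c))) * f (- y + r n * w))"
      using lborel_integral_real_affine[OF r(2), of "\<lambda>s. of_real (sqrt (pi / c) * exp (- (s + y)\<^sup>2 / (4 * c))) * f s" n "-y"] r(1)[of n]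
      by simp
    also have "\<dots> = of_real (r n * sqrt (pi / c)) * (LINT w|lborel. of_real (exp (- (r n * w)\<^sup>2 / (4 * c))) * f (- y + r n * w))"
      by (simp add: scaleR_conv_of_real mult.assoc)
    also have "r n * sqrt (pi / c) = sqrt (2 * pi)" using r(1)[of n] by (simp add: c_def real_sqrt_divide real_sqrt_mult)
    also have "(\<lambda>w. - (r n * w)\<^sup>2 / (4 * c)) = (\<lambda>w. - (w\<^sup>2 / 2))" 
      using r[of n] by (auto simp: c_def power_mult_distrib field_simps)
    then have "(\<lambda>w. of_real (exp (- (r n * w)\<^sup>2 / (4 * c))) * f (- y + r n * w)) = (\<lambda>w. of_real (exp (- (w\<^sup>2 / 2))) * f (- y + r n * w))"
      by metis
    finally show ?thesis .
  qed
  \<comment> \<open>The damping disappears in the limit; integrability of \<open>fourier f\<close>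
    supplies the majorant.\<close>
  have lim1: "(\<lambda>n. LINT x|lborel. fourier f x * (of_real (exp (- ((r n)\<^sup>2 / 2) * x\<^sup>2)) * cis (- y * x)))
     \<longlonglongrightarrow> (LINT x|lborel. fourier f x * (of_real (exp (- (0\<^sup>2 / 2) * x\<^sup>2)) * cis (- y * x)))"
  proof (rule integral_dominated_convergence[where w="\<lambda>x. norm (fourier f x)"])
    show "AE x in lborel. (\<lambda>n. fourier f x * (of_real (exp (- ((r n)\<^sup>2 / 2) * x\<^sup>2)) * cis (- y * x)))
        \<longlonglongrightarrow> fourier f x * (of_real (exp (- (0\<^sup>2 / 2) * x\<^sup>2)) * cis (- y * x))"
    proof (intro AE_I2 tendsto_mult tendsto_const tendsto_of_real)
      show "(\<lambda>n. exp (- ((r n)\<^sup>2 / 2) * x\<^sup>2)) \<longlonglongrightarrow> exp (- (0\<^sup>2 / 2) * x\<^sup>2)" for x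
        by (rule tendsto_eq_intros r0 refl | simp)+
    qed
  qed (use assms in \<open>auto simp: norm_mult intro!: mult_left_le\<close>)
  have lim1_eq: "(LINT x|lborel. fourier f x * (of_real (exp (- (0\<^sup>2 / 2) * x\<^sup>2)) * cis (- y * x))) = fourier (fourier f) y"
    by (simp add: fourier_def mult_ac)
  have gauss: "integrable lborel (\<lambda>w::real. exp (- (w\<^sup>2 / 2)))"
    using fourier_gaussian(1)[of "1/2"] by simp
  \<comment> \<open>On this side continuity of \<open>f\<close> gives the pointwise limit and its
    boundedness gives the majorant.\<close>
  have "(\<lambda>n. LINT w|lborel. of_real (exp (- (w\<^sup>2 / 2))) * f (- y + r n * w))
     \<longlonglongrightarrow> (LINT w|lborel. of_real (exp (- (w\<^sup>2 / 2))) * f (- y + 0 * w))"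
  proof (rule integral_dominated_convergence[where w="\<lambda>w. B * exp (- (w\<^sup>2 / 2))"])
    show "AE x in lborel. (\<lambda>n. of_real (exp (- (x\<^sup>2 / 2))) * f (- y + r n * x)) \<longlonglongrightarrow> of_real (exp (- (x\<^sup>2 / 2))) * f (- y + 0 * x)"
      by (intro AE_I2 tendsto_intros continuous_on_tendsto_compose[OF cont] r0) auto
  qed (use gauss bound in \<open>auto simp: norm_mult\<close>)
  then have lim2: "(\<lambda>n. of_real (sqrt (2 * pi)) * (LINT w|lborel. of_real (exp (- (w\<^sup>2 / 2))) * f (- y + r n * w)))
     \<longlonglongrightarrow> of_real (sqrt (2 * pi)) * (LINT w|lborel. of_real (exp (- (w\<^sup>2 / 2))) * f (- y))"
    by (intro tendsto_intros) simp_all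
  have "(LINT w::real|lborel. of_real (exp (- (w\<^sup>2 / 2))) * f (- y)) = of_real (sqrt (2 * pi)) * f (- y)"
    using fourier_gaussian(2)[of "1/2" 0] by (simp add: fourier_def mult.commute)
  \<comment> \<open>One factor \<open>sqrt (2 * pi)\<close> comes from \<open>eq\<close>, the other
    is the total mass of the Gaussian.\<close>
  moreover have "of_real (sqrt (2 * pi)) * (of_real (sqrt (2 * pi)) * f (- y)) = 2 * pi * f (- y)"
    by (simp flip: of_real_mult mult.assoc)
  ultimately have lim2_eq: "of_real (sqrt (2 * pi)) * (LINT w::real|lborel. of_real (exp (- (w\<^sup>2 / 2))) * f (- y)) = 2 * pi * f (- y)"
    by (simp only:)
  show ?thesis
    using LIMSEQ_unique[OF lim1[unfolded eq lim1_eq] lim2[unfolded lim2_eq]] .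
qed

section \<open>The Airy function\<close>

definition airy_phase :: "real \<Rightarrow> complex \<Rightarrow> complex" where
  "airy_phase x z = exp (z ^ 3 / 3 - of_real x * z)"

text \<open>The real part of the cube contributes \<open>- c * s\<^sup>2\<close>: Gaussian decay on
  every line with c > 0, against constant modulus 1 on the imaginary axis, where convergence is only
  conditional.\<close>

lemma norm_airy_phase: "norm (airy_phase x (Complex c s)) = exp (c ^ 3 / 3 - c * s\<^sup>2 - x * c)"
proof -
  have "Complex c s ^ 3 / 3 - of_real x * Complex c s = Complex (c ^ 3 / 3 - c * s\<^sup>2 - x * c) (c\<^sup>2 * s - s ^ 3 / 3 - x * s)"
    by (simp add: complex_eq_iff power3_eq_cube power2_eq_square field_simps)
  then show ?thesis by (simp add: airy_phase_def)
qed

lemma continuous_on_airy_phase [continuous_intros]: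
  "continuous_on S g \<Longrightarrow> continuous_on S (\<lambda>s. airy_phase x (g s))"
  unfolding airy_phase_def by (intro continuous_intros) auto

lemma airy_phase_imaginary_axis: "airy_phase x (Complex 0 s) = cis (- (s ^ 3 / 3 + x * s))"
proof -
  have "Complex 0 s ^ 3 / 3 - of_real x * Complex 0 s = \<i> * of_real (- (s ^ 3 / 3 + x * s))"
    by (simp add: complex_eq_iff power3_eq_cube)
  then show ?thesis by (simp add: airy_phase_def cis_conv_exp)
qed

lemma airy_phase_integrable:
  assumes "c > 0"
  shows "integrable lborel (\<lambda>s. airy_phase x (Complex c s))"
proof (rule Bochner_Integration.integrable_bound)
  show "integrable lborel (\<lambda>s. exp (c ^ 3 / 3 - x * c) * exp (- c * s\<^sup>2))"
    by (intro integrable_mult_right fourier_gaussian(1) assms)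
  show "(\<lambda>s. airy_phase x (Complex c s)) \<in> borel_measurable lborel"
    by (simp, intro borel_measurable_continuous_onI continuous_intros)
qed (auto simp: norm_airy_phase simp flip: exp_add)

text \<open>By Cauchy's theorem only the two horizontal sides of the rectangle contribute; on them
  the integrand is \<open>O (exp (- t R\<^sup>2))\<close>. A primitive replaces the contour integrals.\<close>

lemma airy_phase_shift_bound:
  assumes "c > 0" "R > 0"
  shows "norm (integral {-R..R} (\<lambda>s. airy_phase x (Complex c s)) - integral {-R..R} (\<lambda>s. airy_phase x (Complex 0 s)))
           \<le> 2 * exp (c ^ 3 / 3 + \<bar>x\<bar> * c) / R\<^sup>2"
proof -
  have "airy_phase x holomorphic_on UNIV"
    unfolding airy_phase_def by (intro holomorphic_intros) auto
  then obtain P where P: "\<And>z. (P has_field_derivative airy_phase x z) (at z)"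
    using holomorphic_convex_primitive'[of UNIV "airy_phase x"] by auto
  \<comment> \<open>Along a vertical line dz = i ds, hence the division by
    \<open>\<i>\<close>.\<close>
  have vert: "integral {-R..R} (\<lambda>s. airy_phase x (Complex a s)) = (P (Complex a R) - P (Complex a (-R))) / \<i>" for a
  proof (rule integral_unique)
    have "((\<lambda>s. Complex a s) has_vector_derivative \<i>) (at s)" for s
      unfolding Complex_eq by (auto intro!: derivative_eq_intros)
    from field_vector_diff_chain_at[OF this P]
    have "((\<lambda>s. P (Complex a s)) has_vector_derivative \<i> * airy_phase x (Complex a s)) (at s)" for s
      by (simp add: o_def)
    from has_vector_derivative_mult_left[OF this, where a="inverse \<i>"]
    have "((\<lambda>s. P (Complex a s) / \<i>) has_vector_derivative airy_phase x (Complex a s)) (at s)" for s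
      by (simp add: field_simps)
    with assms have "((\<lambda>s. airy_phase x (Complex a s)) has_integral (P (Complex a R) / \<i> - P (Complex a (-R)) / \<i>)) {-R..R}"
      by (intro fundamental_theorem_of_calculus) (auto intro: has_vector_derivative_at_within)
    then show "((\<lambda>s. airy_phase x (Complex a s)) has_integral (P (Complex a R) - P (Complex a (-R))) / \<i>) {-R..R}"
      by (simp add: right_diff_distrib)
  qed
  define K where "K = exp (c ^ 3 / 3 + \<bar>x\<bar> * c)"
  \<comment> \<open>The condition on \<open>r\<close> covers the top side \<open>r = R\<close> and
    the bottom side \<open>r = -R\<close> together.\<close>
  have horiz: "norm (P (Complex c r) - P (Complex 0 r)) \<le> K / R\<^sup>2" if "r\<^sup>2 = R\<^sup>2" for r
  proof -
    have d: "((\<lambda>t. Complex t r) has_vector_derivative 1) (at t)" for t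
      unfolding Complex_eq by (auto intro!: derivative_eq_intros)
    have d1: "((\<lambda>t. P (Complex t r)) has_vector_derivative airy_phase x (Complex t r)) (at t)" for t
      using field_vector_diff_chain_at[OF d P] by (simp add: o_def)
    \<comment> \<open>A primitive of the majorant \<open>K * exp (- (t * R\<^sup>2))\<close>; the
      mean value inequality bounds the increment of \<open>P\<close> by the increment of this
      function.\<close>
    have d2: "((\<lambda>t. - K * exp (- (t * R\<^sup>2)) / R\<^sup>2) has_vector_derivative K * exp (- (t * R\<^sup>2))) (at t)" for t
      unfolding has_real_derivative_iff_has_vector_derivative[symmetric]
      using assms by (auto intro!: derivative_eq_intros simp: field_simps)
    have "norm (P (Complex c r) - P (Complex 0 r)) \<le> (- K * exp (- (c * R\<^sup>2)) / R\<^sup>2) - (- K * exp (- (0 * R\<^sup>2)) / R\<^sup>2)"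
    proof (rule differentiable_bound_general[OF \<open>c > 0\<close> _ _ d1 d2])
      show "continuous_on {0..c} (\<lambda>t. P (Complex t r))"
        using d1 by (meson continuous_at_imp_continuous_on has_vector_derivative_continuous)
      show "continuous_on {0..c} (\<lambda>t. - K * exp (- (t * R\<^sup>2)) / R\<^sup>2)"
        using assms by (intro continuous_intros) auto
      fix t assume t: "0 < t" "t < c"
      have "t ^ 3 / 3 - t * r\<^sup>2 - x * t \<le> c ^ 3 / 3 + \<bar>x\<bar> * c + - (t * R\<^sup>2)"
      proof -
        have "t ^ 3 \<le> c ^ 3" using t by (intro power_mono) auto
        moreover have "- x * t \<le> \<bar>x\<bar> * c" using t by (intro mult_mono) auto
        ultimately show ?thesis using that by simp
      qed
      then show "norm (airy_phase x (Complex t r)) \<le> K * exp (- (t * R\<^sup>2))"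
        by (simp add: norm_airy_phase K_def flip: exp_add)
    qed
    also have "\<dots> \<le> K / R\<^sup>2"
      using assms by (simp add: K_def)
    finally show ?thesis .
  qed
  have "norm ((P (Complex c R) - P (Complex 0 R)) - (P (Complex c (-R)) - P (Complex 0 (-R)))) \<le> K / R\<^sup>2 + K / R\<^sup>2"
    by (intro norm_triangle_le_diff add_mono horiz) auto
  also have "(P (Complex c R) - P (Complex 0 R)) - (P (Complex c (-R)) - P (Complex 0 (-R)))
     = \<i> * (integral {-R..R} (\<lambda>s. airy_phase x (Complex c s)) - integral {-R..R} (\<lambda>s. airy_phase x (Complex 0 s)))"
    unfolding vert by (simp add: algebra_simps)
  finally show ?thesis by (simp add: norm_mult K_def)
qed

text \<open>The exponent is odd in \<open>s\<close>, so the values at \<open>s\<close> and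
  \<open>- s\<close> are conjugate and add up to twice a cosine. This links the contour to the
  one-sided integral defining \<open>Ai\<close>.\<close>

lemma airy_phase_integral_imaginary_axis:
  assumes "R \<ge> 0"
  shows "integral {-R..R} (\<lambda>s. airy_phase x (Complex 0 s)) = of_real (2 * integral {0..R} (\<lambda>s. cos (s ^ 3 / 3 + x * s)))"
proof -
  let ?f = "\<lambda>s. airy_phase x (Complex 0 s)"
  have int: "?f integrable_on {a..b}" "(\<lambda>s. ?f (- s)) integrable_on {a..b}" for a b
    by (intro integrable_continuous_interval continuous_intros)+
  have "integral {-R..R} ?f = integral {-R..0} ?f + integral {0..R} ?f"
    using assms by (intro Henstock_Kurzweil_Integration.integral_combine[symmetric] int) auto
  also have "integral {-R..0} ?f = integral {0..R} (\<lambda>s. ?f (- s))"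
    using Henstock_Kurzweil_Integration.integral_reflect_real[of R 0 "\<lambda>s. ?f (- s)"] by simp
  also have "\<dots> + integral {0..R} ?f = integral {0..R} (\<lambda>s. ?f s + ?f (- s))"
    using Henstock_Kurzweil_Integration.integral_add[OF int] by (simp add: add.commute)
  also have "\<dots> = integral {0..R} (\<lambda>s. of_real (2 * cos (s ^ 3 / 3 + x * s)))"
  proof (intro arg_cong[where f="integral {0..R}"] ext)
    fix s
    have *: "cis (- t) + cis t = of_real (2 * cos t)" for t
      by (simp add: complex_eq_iff)
    have "(- s) ^ 3 / 3 + x * (- s) = - (s ^ 3 / 3 + x * s)" by (simp add: power3_eq_cube)
    then show "?f s + ?f (- s) = of_real (2 * cos (s ^ 3 / 3 + x * s))"
      by (simp only: airy_phase_imaginary_axis minus_minus *)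
  qed
  also have "\<dots> = of_real (integral {0..R} (\<lambda>s. 2 * cos (s ^ 3 / 3 + x * s)))"
    by (intro integral_unique has_integral_of_real integrable_integral integrable_continuous_interval continuous_intros) auto
  finally show ?thesis by simp
qed

text \<open>Truncated integrals on the shifted line converge absolutely, and those on the imaginary
  axis differ from them by \<open>O(1/R\<^sup>2)\<close>. So the improper integral in
  \<open>Ai\<close> converges, which is what gives its \<open>Lim\<close> a meaning.\<close>

lemma Ai_eq_contour_integral:
  assumes "c > 0"
  shows "complex_of_real (2 * pi * Ai x) = (LINT s|lborel. airy_phase x (Complex c s))"
proof -
  let ?f = "\<lambda>s. airy_phase x (Complex c s)" and ?L = "LINT s|lborel. airy_phase x (Complex c s)"
  have int: "integral {-R..R} ?f = (LINT s|lborel. indicator {-R..R} s *\<^sub>R ?f s)" for R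
    using set_borel_integral_eq_integral(2)[OF borel_integrable_atLeastAtMost', of "-R" R ?f]
    by (simp add: set_lebesgue_integral_def continuous_intros)
  have "((\<lambda>R. LINT s|lborel. indicator {-R..R} s *\<^sub>R ?f s) \<longlongrightarrow> ?L) at_top"
  proof (rule integral_dominated_convergence_at_top[where w="\<lambda>s. norm (?f s)"])
    show "AE s in lborel. ((\<lambda>R. indicator {-R..R} s *\<^sub>R ?f s) \<longlongrightarrow> ?f s) at_top"
    proof (rule AE_I2)
      fix s
      have "eventually (\<lambda>R. indicator {-R..R} s *\<^sub>R ?f s = ?f s) at_top"
        using eventually_ge_at_top[of "\<bar>s\<bar>"] by eventually_elim (auto simp: indicator_def)
      then show "((\<lambda>R. indicator {-R..R} s *\<^sub>R ?f s) \<longlongrightarrow> ?f s) at_top"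
        by (rule tendsto_eventually)
    qed
  qed (use airy_phase_integrable[OF assms, of x] in \<open>auto simp: indicator_def dest: borel_measurable_integrable\<close>)
  then have 1: "((\<lambda>R. integral {-R..R} ?f) \<longlongrightarrow> ?L) at_top"
    unfolding int .
  have 2: "((\<lambda>R. integral {-R..R} ?f - integral {-R..R} (\<lambda>s. airy_phase x (Complex 0 s))) \<longlongrightarrow> 0) at_top"
  proof (rule Lim_null_comparison)
    show "eventually (\<lambda>R. norm (integral {-R..R} ?f - integral {-R..R} (\<lambda>s. airy_phase x (Complex 0 s)))
        \<le> 2 * exp (c ^ 3 / 3 + \<bar>x\<bar> * c) / R\<^sup>2) at_top"
      using eventually_gt_at_top[of 0] by eventually_elim (rule airy_phase_shift_bound[OF assms])
    show "((\<lambda>R::real. 2 * exp (c ^ 3 / 3 + \<bar>x\<bar> * c) / R\<^sup>2) \<longlongrightarrow> 0) at_top"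
      by (intro tendsto_divide_0[OF tendsto_const] filterlim_at_top_imp_at_infinity filterlim_pow_at_top filterlim_ident) simp
  qed
  have "((\<lambda>R. integral {-R..R} (\<lambda>s. airy_phase x (Complex 0 s))) \<longlongrightarrow> ?L) at_top"
    using tendsto_diff[OF 1 2] by simp
  moreover have "eventually (\<lambda>R. integral {-R..R} (\<lambda>s. airy_phase x (Complex 0 s))
      = of_real (2 * integral {0..R} (\<lambda>s. cos (s ^ 3 / 3 + x * s)))) at_top"
    using eventually_ge_at_top[of 0] by eventually_elim (rule airy_phase_integral_imaginary_axis)
  ultimately have L: "((\<lambda>R. complex_of_real (2 * integral {0..R} (\<lambda>s. cos (s ^ 3 / 3 + x * s)))) \<longlongrightarrow> ?L) at_top"
    by (rule Lim_transform_eventually)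
  have "((\<lambda>R. integral {0..R} (\<lambda>s. cos (s ^ 3 / 3 + x * s))) \<longlongrightarrow> Re ?L / 2) at_top"
    using tendsto_divide[OF tendsto_Re[OF L] tendsto_const[of 2]] by simp
  then have "Lim at_top (\<lambda>R. integral {0..R} (\<lambda>s. cos (s ^ 3 / 3 + x * s))) = Re ?L / 2"
    by (intro tendsto_Lim) auto
  then have "2 * pi * Ai x = Re ?L" by (simp add: Ai_def)
  \<comment> \<open>\<open>?L\<close> is a limit of real numbers.\<close>
  moreover have "Im ?L = 0"
    using tendsto_Im[OF L] by (simp add: tendsto_const_iff)
  ultimately show ?thesis by (simp add: complex_eq_iff)
qed

section \<open>Ai as a Fourier transform: decay and integrability\<close>

lemma Ai_eq_fourier:
  assumes "c > 0"
  shows "complex_of_real (2 * pi * (exp (c * x) * Ai x)) = fourier (\<lambda>s. airy_phase 0 (Complex c s)) x"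
proof -
  have "of_real (exp (c * x)) * airy_phase x (Complex c s) = airy_phase 0 (Complex c s) * cis (- (s * x))" for s
    by (simp add: airy_phase_def cis_conv_exp Complex_eq algebra_simps flip: exp_of_real exp_add)
  then have "fourier (\<lambda>s. airy_phase 0 (Complex c s)) x = (LINT s|lborel. of_real (exp (c * x)) * airy_phase x (Complex c s))"
    by (simp add: fourier_def)
  also have "\<dots> = of_real (exp (c * x)) * of_real (2 * pi * Ai x)"
    using Ai_eq_contour_integral[OF assms, of x] by simp
  finally show ?thesis by (simp add: mult_ac)
qed

text \<open>A Fourier transform is bounded by the L1 norm of its source. The choice of
  \<open>c\<close> is free: large \<open>c\<close> gives decay to the right, small \<open>c\<close>
  limits the growth allowed to the left.\<close>

lemma Ai_exponential_bound:
  assumes "c > 0"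
  obtains C where "\<And>x. \<bar>Ai x\<bar> \<le> C * exp (- (c * x))"
proof
  let ?L = "LINT s|lborel. norm (airy_phase 0 (Complex c s))"
  fix x
  have "norm (complex_of_real (2 * pi * (exp (c * x) * Ai x))) \<le> ?L"
    unfolding Ai_eq_fourier[OF assms] by (rule norm_fourier_le)
  then have "2 * pi * (exp (c * x) * \<bar>Ai x\<bar>) \<le> ?L"
    by (simp only: norm_of_real abs_mult) simp
  then show "\<bar>Ai x\<bar> \<le> ?L / (2 * pi) * exp (- (c * x))"
    by (simp add: exp_minus field_simps)
qed

lemma continuous_on_Ai [continuous_intros]:
  assumes "continuous_on S g"
  shows "continuous_on S (\<lambda>x. Ai (g x))"
proof -
  have "Ai x = Re (fourier (\<lambda>s. airy_phase 0 (Complex 1 s)) x) / (2 * pi * exp x)" for x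
    using arg_cong[OF Ai_eq_fourier[of 1 x], of Re] by (simp add: field_simps)
  then have "continuous_on UNIV Ai"
    by (subst continuous_on_cong[OF refl])
       (auto intro!: continuous_intros continuous_on_fourier airy_phase_integrable)
  from continuous_on_compose2[OF this assms] show ?thesis by simp
qed

lemma borel_measurable_Ai [measurable]: "Ai \<in> borel_measurable borel"
  by (intro borel_measurable_continuous_onI continuous_intros)

lemma integrable_exp_neg_abs:
  assumes "a > (0::real)"
  shows "integrable lborel (\<lambda>x. exp (- (a * \<bar>x\<bar>)))"
proof -
  have "set_integrable lebesgue {0..} (\<lambda>x. exp (- a * x))"
    by (intro nonnegative_absolutely_integrable_1 integrable_on_exp_minus_to_infinity assms) auto
  then have "integrable lborel (\<lambda>x. indicator {0..} x *\<^sub>R exp (- (a * x)))"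
    unfolding set_integrable_def by (subst (asm) integrable_completion) auto
  also have "(\<lambda>x. indicator {0..} x *\<^sub>R exp (- (a * x))) = (\<lambda>x. indicator {0..} x *\<^sub>R exp (- (a * \<bar>x\<bar>)))"
    by (auto simp: indicator_def)
  finally show ?thesis
    using has_bochner_integral_even_function[of "\<lambda>x. exp (- (a * \<bar>x\<bar>))"]
    by (auto simp: has_bochner_integral_iff)
qed

text \<open>Rate \<open>2 * c\<close> beats the weight for \<open>x \<ge> 0\<close>, while rate
  \<open>c / 2\<close> leaves \<open>exp (c / 2 * x)\<close> for \<open>x < 0\<close>; both are
  dominated by a two-sided exponential of rate \<open>c / 2\<close>.\<close>

lemma integrable_exp_mult_Ai:
  assumes "c > 0"
  shows "integrable lborel (\<lambda>x. exp (c * x) * Ai x)"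
proof -
  obtain C where C: "\<And>x. \<bar>Ai x\<bar> \<le> C * exp (- (2 * c * x))"
    using Ai_exponential_bound[of "2 * c"] assms by auto
  obtain D where D: "\<And>x. \<bar>Ai x\<bar> \<le> D * exp (- (c / 2 * x))"
    using Ai_exponential_bound[of "c / 2"] assms by auto
  have nonneg: "C \<ge> 0" "D \<ge> 0" using C[of 0] D[of 0] by auto
  have "exp (c * x) * \<bar>Ai x\<bar> \<le> (C + D) * exp (- (c / 2 * \<bar>x\<bar>))" for x
  proof (cases "x \<ge> 0")
    case True
    have "exp (c * x) * \<bar>Ai x\<bar> \<le> exp (c * x) * (C * exp (- (2 * c * x)))"
      using C by (intro mult_left_mono) auto
    also have "\<dots> = C * exp (- (c * x))" by (simp flip: exp_add)
    also have "\<dots> \<le> (C + D) * exp (- (c / 2 * x))"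
      using nonneg assms True by (intro mult_mono) auto
    finally show ?thesis using True by simp
  next
    case False
    have "exp (c * x) * \<bar>Ai x\<bar> \<le> exp (c * x) * (D * exp (- (c / 2 * x)))"
      using D by (intro mult_left_mono) auto
    also have "\<dots> = D * exp (c / 2 * x)" by (simp flip: exp_add)
    also have "\<dots> \<le> (C + D) * exp (c / 2 * x)"
      using nonneg by (intro mult_right_mono) auto
    finally show ?thesis using False by simp
  qed
  then show ?thesis
    using assms nonneg
    by (intro Bochner_Integration.integrable_bound[OF integrable_mult_right[OF integrable_exp_neg_abs[of "c / 2"], of "C + D"]])
       (auto simp: abs_mult)
qed

text \<open>Inversion of \<open>Ai_eq_fourier\<close>: the factors \<open>2 * pi\<close> cancel, and
  the reflection from inversion produces \<open>- s\<close>.\<close>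

lemma fourier_exp_mult_Ai:
  assumes "c > 0"
  shows "fourier (\<lambda>x. of_real (exp (c * x) * Ai x)) s = airy_phase 0 (Complex c (- s))"
proof -
  let ?f = "\<lambda>s. airy_phase 0 (Complex c s)"
  have eq: "fourier ?f = (\<lambda>x. complex_of_real (2 * pi * (exp (c * x) * Ai x)))"
    using Ai_eq_fourier[OF assms] by auto
  have "fourier (fourier ?f) s = 2 * pi * ?f (- s)"
  proof (rule fourier_inversion)
    show "integrable lborel (fourier ?f)"
      unfolding eq complex_of_real_integrable_eq by (intro integrable_mult_right integrable_exp_mult_Ai assms)
    show "norm (?f x) \<le> exp (c ^ 3 / 3)" for x
      using assms by (simp add: norm_airy_phase)
  qed (intro airy_phase_integrable assms continuous_intros)+
  also have "fourier (fourier ?f) s = 2 * pi * fourier (\<lambda>x. of_real (exp (c * x) * Ai x)) s"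
    unfolding eq by (simp add: fourier_def mult.assoc)
  finally show ?thesis by simp
qed

section \<open>Exponentially weighted integrals of Airy products\<close>

text \<open>Half of the weight goes to each factor: one weighted Airy function is integrable, the
  other bounded.\<close>

lemma integrable_exp_mult_Ai_Ai:
  assumes "a > 0"
  shows "integrable lborel (\<lambda>l. exp (a * l) * Ai (x + l) * Ai (y + l))"
proof -
  obtain C where C: "\<And>x. \<bar>Ai x\<bar> \<le> C * exp (- (a / 2 * x))"
    using Ai_exponential_bound[of "a / 2"] assms by auto
  have "integrable lborel (\<lambda>l. exp (a / 2 * (x + 1 * l)) * Ai (x + 1 * l))"
    using assms by (intro lborel_integrable_real_affine integrable_exp_mult_Ai) auto
  then have "integrable lborel (\<lambda>l. C * exp (- (a / 2 * (x + y))) * (exp (a / 2 * (x + l)) * Ai (x + l)))"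
    by (intro integrable_mult_right) simp
  then show ?thesis
  proof (rule Bochner_Integration.integrable_bound)
    have "exp (a * l) * \<bar>Ai (x + l)\<bar> * \<bar>Ai (y + l)\<bar> \<le> exp (a * l) * \<bar>Ai (x + l)\<bar> * (C * exp (- (a / 2 * (y + l))))" for l
      by (intro mult_left_mono C) auto
    also have "exp (a * l) * \<bar>Ai (x + l)\<bar> * (C * exp (- (a / 2 * (y + l))))
        = C * exp (- (a / 2 * (x + y))) * (exp (a / 2 * (x + l)) * \<bar>Ai (x + l)\<bar>)" for l
      by (simp add: field_simps flip: exp_add)
    finally show "AE l in lborel. norm (exp (a * l) * Ai (x + l) * Ai (y + l))
        \<le> norm (C * exp (- (a / 2 * (x + y))) * (exp (a / 2 * (x + l)) * Ai (x + l)))"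
      using C[of 0] by (simp add: abs_mult)
  qed measurable
qed

text \<open>With the weight split evenly, Parseval pairs the transforms at conjugate points. Their
  cubic phases cancel, and what remains is a Gaussian transform at \<open>y - x\<close>.\<close>

lemma integral_exp_mult_Ai_Ai:
  assumes "a > 0"
  shows "(LINT l|lborel. exp (a * l) * Ai (x + l) * Ai (y + l))
    = exp (a ^ 3 / 12 - a * (x + y) / 2 - (x - y)\<^sup>2 / (4 * a)) / sqrt (4 * pi * a)" (is "?I = _")
proof -
  define c where "c = a / 2"
  define d where "d = y - x"
  have c: "c > 0" "a = 2 * c" using assms by (auto simp: c_def)
  let ?g = "\<lambda>m. complex_of_real (exp (c * m) * Ai m)" and ?f = "\<lambda>s. airy_phase 0 (Complex c s)"
  have f_int: "integrable lborel (\<lambda>s. ?f s * cis (- d * s))"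
    by (rule Bochner_Integration.integrable_bound[OF airy_phase_integrable[OF c(1), of 0]])
       (use airy_phase_integrable[OF c(1), of 0] in \<open>auto simp: norm_mult dest!: borel_measurable_integrable\<close>)
  have g_int: "integrable lborel ?g"
    unfolding complex_of_real_integrable_eq by (rule integrable_exp_mult_Ai[OF c(1)])
  \<comment> \<open>In the sum of the cubes of conjugate points the imaginary parts cancel and the
    \<open>- c * s\<^sup>2\<close> terms double.\<close>
  have ff: "?f (- s) * ?f s = of_real (exp (2 * c ^ 3 / 3) * exp (- (2 * c) * s\<^sup>2))" for s
  proof -
    have "Complex c (- s) ^ 3 / 3 + Complex c s ^ 3 / 3 = of_real (2 * c ^ 3 / 3 + - (2 * c) * s\<^sup>2)"
      by (simp add: complex_eq_iff power3_eq_cube power2_eq_square field_simps)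
    then show ?thesis
      by (simp only: airy_phase_def flip: exp_add exp_of_real) simp
  qed
  have "?I = (LINT m|lborel. exp (a * (- x + 1 * m)) * Ai (x + (- x + 1 * m)) * Ai (y + (- x + 1 * m)))"
    using lborel_integral_real_affine[of 1 "\<lambda>l. exp (a * l) * Ai (x + l) * Ai (y + l)" "- x"] by simp
  also have "\<dots> = (LINT m|lborel. exp (- c * (x + y)) * ((exp (c * m) * Ai m) * (exp (c * (m + d)) * Ai (m + d))))"
  proof (rule Bochner_Integration.integral_cong[OF refl])
    fix m
    have "exp (a * (- x + 1 * m)) = exp (- c * (x + y)) * (exp (c * m) * exp (c * (m + d)))"
      by (simp add: c d_def algebra_simps flip: exp_add)
    moreover have "x + (- x + 1 * m) = m" "y + (- x + 1 * m) = m + d" by (simp_all add: d_def)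
    ultimately show "exp (a * (- x + 1 * m)) * Ai (x + (- x + 1 * m)) * Ai (y + (- x + 1 * m))
      = exp (- c * (x + y)) * ((exp (c * m) * Ai m) * (exp (c * (m + d)) * Ai (m + d)))"
      by (simp only: mult_ac)
  qed
  finally have I: "?I = exp (- c * (x + y)) * (LINT m|lborel. (exp (c * m) * Ai m) * (exp (c * (m + d)) * Ai (m + d)))" (is "_ = _ * ?J")
    by simp
  have "complex_of_real (2 * pi * ?J) = (LINT m|lborel. of_real (2 * pi * ((exp (c * m) * Ai m) * (exp (c * (m + d)) * Ai (m + d)))))"
    by (simp only: integral_complex_of_real integral_mult_right_zero)
  also have "\<dots> = (LINT m|lborel. ?g m * of_real (2 * pi * (exp (c * (m + d)) * Ai (m + d))))"
    by (simp add: mult_ac)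
  \<comment> \<open>Modulation by \<open>cis (- d * s)\<close> realises the translation of the
    second Airy factor by \<open>d\<close>.\<close>
  also have "\<dots> = (LINT m|lborel. ?g m * fourier (\<lambda>s. ?f s * cis (- d * s)) m)"
    unfolding Ai_eq_fourier[OF c(1)] fourier_modulation by simp
  also have "\<dots> = (LINT s|lborel. fourier ?g s * (?f s * cis (- d * s)))"
    by (rule fourier_multiplication_formula[OF g_int f_int])
  also have "\<dots> = (LINT s|lborel. of_real (exp (2 * c ^ 3 / 3)) * (of_real (exp (- (2 * c) * s\<^sup>2)) * cis (- (s * d))))"
    unfolding fourier_exp_mult_Ai[OF c(1)] mult.assoc[symmetric] ff by (simp add: mult_ac)
  also have "\<dots> = of_real (exp (2 * c ^ 3 / 3)) * fourier (\<lambda>s. of_real (exp (- (2 * c) * s\<^sup>2))) d"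
    by (simp add: fourier_def)
  also have "\<dots> = of_real (exp (2 * c ^ 3 / 3) * (sqrt (pi / (2 * c)) * exp (- d\<^sup>2 / (4 * (2 * c)))))"
    using c(1) by (subst fourier_gaussian(2)) simp_all
  finally have J: "2 * pi * ?J = exp (2 * c ^ 3 / 3) * (sqrt (pi / (2 * c)) * exp (- d\<^sup>2 / (4 * (2 * c))))"
    by (simp only: of_real_eq_iff)
  have "sqrt (pi / a) * sqrt (4 * pi * a) = 2 * pi"
    using assms by (simp add: real_sqrt_mult real_sqrt_divide)
  then have "sqrt (pi / a) = 2 * pi / sqrt (4 * pi * a)"
    using assms by (simp add: field_simps)
  then have "2 * pi * ?J = 2 * pi * (exp (2 * c ^ 3 / 3) * exp (- d\<^sup>2 / (4 * a)) / sqrt (4 * pi * a))"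
    using J by (simp add: c(2) mult_ac)
  then have "?J = exp (2 * c ^ 3 / 3) * exp (- d\<^sup>2 / (4 * a)) / sqrt (4 * pi * a)"
    by (simp only: mult_cancel_left) simp
  then have "?I = exp (- c * (x + y)) * (exp (2 * c ^ 3 / 3) * exp (- d\<^sup>2 / (4 * a))) / sqrt (4 * pi * a)"
    using I by simp
  also have "exp (- c * (x + y)) * (exp (2 * c ^ 3 / 3) * exp (- d\<^sup>2 / (4 * a)))
      = exp (a ^ 3 / 12 - a * (x + y) / 2 - (x - y)\<^sup>2 / (4 * a))"
    unfolding exp_add[symmetric]
    by (rule arg_cong[where f=exp]) (simp add: c(2) d_def power3_eq_cube power2_commute)
  finally show ?thesis .
qed

section \<open>The two limits of the kernel\<close>

text \<open>The Fermi factor differs from \<open>exp (\<alpha> l)\<close> by at most \<open>exp (2 \<alpha> l)\<close>.\<close>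

lemma M_kernel_approx:
  assumes "\<alpha> > 0"
  shows "\<bar>M_kernel \<alpha> x y - (LINT l|lborel. exp (\<alpha> * l) * Ai (x + l) * Ai (y + l))\<bar>
    \<le> ((LINT l|lborel. exp (2 * \<alpha> * l) * Ai (x + l) * Ai (x + l)) + (LINT l|lborel. exp (2 * \<alpha> * l) * Ai (y + l) * Ai (y + l))) / 2"
proof -
  let ?w = "\<lambda>l. exp (\<alpha> * l) / (exp (\<alpha> * l) + 1)"
  note int = integrable_exp_mult_Ai_Ai[OF assms, of x y]
  have pos: "exp t + 1 > 0" for t :: real by (simp add: add_pos_pos)
  have w: "0 \<le> ?w l" "?w l \<le> exp (\<alpha> * l)" for l
    using pos by (auto simp: divide_le_eq)
  have int': "integrable lborel (\<lambda>l. ?w l * Ai (x + l) * Ai (y + l))"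
  proof (rule Bochner_Integration.integrable_bound[OF int])
    have "\<bar>?w l\<bar> \<le> \<bar>exp (\<alpha> * l)\<bar>" for l using w[of l] by simp
    then show "AE l in lborel. norm (?w l * Ai (x + l) * Ai (y + l)) \<le> norm (exp (\<alpha> * l) * Ai (x + l) * Ai (y + l))"
      unfolding real_norm_def abs_mult by (intro AE_I2 mult_right_mono) auto
  qed measurable
  have diff: "\<bar>?w l - exp (\<alpha> * l)\<bar> \<le> exp (2 * \<alpha> * l)" for l
  proof -
    \<comment> \<open>With q = \<open>exp (\<alpha> * l)\<close> this is q - q/(q+1) =
      q^2/(q+1).\<close>
    have "exp (\<alpha> * l) - ?w l = exp (2 * \<alpha> * l) / (exp (\<alpha> * l) + 1)"
      using pos[of "\<alpha> * l"] by (simp add: field_simps flip: exp_add)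
    also have "\<dots> \<le> exp (2 * \<alpha> * l)" by (simp add: divide_le_eq pos)
    finally show ?thesis using w(2)[of l] by simp
  qed
  have M: "M_kernel \<alpha> x y - (LINT l|lborel. exp (\<alpha> * l) * Ai (x + l) * Ai (y + l))
     = (LINT l|lborel. ?w l * Ai (x + l) * Ai (y + l) - exp (\<alpha> * l) * Ai (x + l) * Ai (y + l))"
    unfolding M_kernel_def by (rule Bochner_Integration.integral_diff[symmetric, OF int' int])
  have "\<bar>M_kernel \<alpha> x y - (LINT l|lborel. exp (\<alpha> * l) * Ai (x + l) * Ai (y + l))\<bar>
     \<le> (LINT l|lborel. \<bar>?w l * Ai (x + l) * Ai (y + l) - exp (\<alpha> * l) * Ai (x + l) * Ai (y + l)\<bar>)"
    unfolding M by (rule integral_abs_bound)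
  also have "\<dots> \<le> (LINT l|lborel. (exp (2 * \<alpha> * l) * Ai (x + l) * Ai (x + l) + exp (2 * \<alpha> * l) * Ai (y + l) * Ai (y + l)) / 2)"
  proof (rule Bochner_Integration.integral_mono)
    fix l
    let ?a = "Ai (x + l)" and ?b = "Ai (y + l)"
    have "?w l * ?a * ?b - exp (\<alpha> * l) * ?a * ?b = (?w l - exp (\<alpha> * l)) * (?a * ?b)"
      by (simp only: left_diff_distrib mult.assoc)
    then have "\<bar>?w l * ?a * ?b - exp (\<alpha> * l) * ?a * ?b\<bar> = \<bar>?w l - exp (\<alpha> * l)\<bar> * \<bar>?a * ?b\<bar>"
      by (simp only: abs_mult)
    \<comment> \<open>The inequality 2|ab| \<le> a^2 + b^2 replaces the absolute value of the mixed
      product by squares, whose integrals the closed formula evaluates at x = y with weight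
      2\<alpha>.\<close>
    also have "\<dots> \<le> exp (2 * \<alpha> * l) * ((?a * ?a + ?b * ?b) / 2)"
    proof (rule mult_mono[OF diff])
      show "\<bar>?a * ?b\<bar> \<le> (?a * ?a + ?b * ?b) / 2"
        using sum_squares_bound[of "\<bar>?a\<bar>" "\<bar>?b\<bar>"] by (simp add: abs_mult power2_eq_square)
    qed auto
    finally show "\<bar>?w l * ?a * ?b - exp (\<alpha> * l) * ?a * ?b\<bar>
        \<le> (exp (2 * \<alpha> * l) * ?a * ?a + exp (2 * \<alpha> * l) * ?b * ?b) / 2"
      by (simp only: distrib_left add_divide_distrib mult.assoc times_divide_eq_right)
  qed (intro integrable_abs Bochner_Integration.integrable_diff int int' integrable_divide_zero
        Bochner_Integration.integrable_add integrable_exp_mult_Ai_Ai impI; use assms in simp)+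
  also have "\<dots> = ((LINT l|lborel. exp (2 * \<alpha> * l) * Ai (x + l) * Ai (x + l)) + (LINT l|lborel. exp (2 * \<alpha> * l) * Ai (y + l) * Ai (y + l))) / 2"
    using assms by (simp add: integrable_exp_mult_Ai_Ai)
  finally show ?thesis .
qed

lemma M_kernel_tendsto_K_Airy: "((\<lambda>\<alpha>. M_kernel \<alpha> u v) \<longlongrightarrow> K_Airy u v) at_top"
  unfolding M_kernel_def K_Airy_def set_lebesgue_integral_def
proof (rule integral_dominated_convergence_at_top[where w="\<lambda>l. \<bar>exp (1 * l) * Ai (u + l) * Ai (v + l)\<bar>"])
  show "integrable lborel (\<lambda>l. \<bar>exp (1 * l) * Ai (u + l) * Ai (v + l)\<bar>)"
    by (intro integrable_abs integrable_exp_mult_Ai_Ai) simp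
  have pos: "exp t + 1 > 0" for t :: real by (simp add: add_pos_pos)
  have "exp (\<alpha> * l) / (exp (\<alpha> * l) + 1) \<le> exp l" if "\<alpha> \<ge> 1" for \<alpha> l :: real
  proof (cases "l \<ge> 0")
    case True
    have "exp (\<alpha> * l) / (exp (\<alpha> * l) + 1) \<le> 1" using pos by (simp add: divide_le_eq)
    also have "1 \<le> exp l" using True by simp
    finally show ?thesis .
  next
    case False
    have "exp (\<alpha> * l) / (exp (\<alpha> * l) + 1) \<le> exp (\<alpha> * l)" using pos by (simp add: divide_le_eq)
    also have "\<dots> \<le> exp l" using False that mult_right_mono_neg[of 1 \<alpha> l] by simp
    finally show ?thesis .
  qed
  then have "\<bar>exp (\<alpha> * l) / (exp (\<alpha> * l) + 1)\<bar> \<le> \<bar>exp (1 * l)\<bar>" if "\<alpha> \<ge> 1" for \<alpha> l :: real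
    using that pos[of "\<alpha> * l"] by simp
  then have "AE l in lborel. norm (exp (\<alpha> * l) / (exp (\<alpha> * l) + 1) * Ai (u + l) * Ai (v + l))
      \<le> \<bar>exp (1 * l) * Ai (u + l) * Ai (v + l)\<bar>" if "\<alpha> \<ge> 1" for \<alpha>
    unfolding real_norm_def abs_mult using that by (intro AE_I2 mult_right_mono) auto
  then show "eventually (\<lambda>\<alpha>. AE l in lborel. norm (exp (\<alpha> * l) / (exp (\<alpha> * l) + 1) * Ai (u + l) * Ai (v + l))
      \<le> \<bar>exp (1 * l) * Ai (u + l) * Ai (v + l)\<bar>) at_top"
    using eventually_ge_at_top[of "1::real"] by (rule eventually_mono[rotated])
  \<comment> \<open>At \<open>l = 0\<close> the factor is constantly 1/2 whereas the indicator is 1;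
    this single point is a null set.\<close>
  have "((\<lambda>\<alpha>. exp (\<alpha> * l) / (exp (\<alpha> * l) + 1)) \<longlongrightarrow> indicator {0..} l) at_top" if "l \<noteq> 0" for l :: real
  proof (cases "l > 0")
    case True
    then have "((\<lambda>\<alpha>. exp (\<alpha> * l) / (exp (\<alpha> * l) + 1)) \<longlongrightarrow> 1) at_top" by real_asymp
    with True show ?thesis by simp
  next
    case False
    with that have "l < 0" by simp
    then have "((\<lambda>\<alpha>. exp (\<alpha> * l) / (exp (\<alpha> * l) + 1)) \<longlongrightarrow> 0) at_top" by real_asymp
    with \<open>l < 0\<close> show ?thesis by simp
  qed
  then have "((\<lambda>\<alpha>. exp (\<alpha> * l) / (exp (\<alpha> * l) + 1) * Ai (u + l) * Ai (v + l)) \<longlongrightarrow> indicator {0..} l * Ai (u + l) * Ai (v + l)) at_top"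
    if "l \<noteq> 0" for l
    using that by (intro tendsto_mult tendsto_const)
  then show "AE l in lborel. ((\<lambda>\<alpha>. exp (\<alpha> * l) / (exp (\<alpha> * l) + 1) * Ai (u + l) * Ai (v + l))
      \<longlongrightarrow> indicator {0..} l *\<^sub>R (Ai (u + l) * Ai (v + l))) at_top"
    using AE_lborel_singleton[of "0::real"] by (auto elim!: eventually_mono simp: mult.assoc)
qed measurable

lemma M_kernel_tendsto_K_ext:
  "((\<lambda>\<alpha>. 1 / \<alpha> * M_kernel \<alpha> (u / \<alpha> - 1 / (2 * \<alpha>) * ln (4 * pi * \<alpha> ^ 3))
                            (v / \<alpha> - 1 / (2 * \<alpha>) * ln (4 * pi * \<alpha> ^ 3))) \<longlongrightarrow> K_ext u v) (at_right 0)"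
proof -
  define X where "X w \<alpha> = w / \<alpha> - 1 / (2 * \<alpha>) * ln (4 * pi * \<alpha> ^ 3)" for w \<alpha> :: real
  define J where "J a x y = (LINT l|lborel. exp (a * l) * Ai (x + l) * Ai (y + l))" for a x y
  \<comment> \<open>Rescaled diagonal integral with weight 2\<alpha>, of order \<alpha>^(3/2); it
    controls the error of replacing the Fermi factor.\<close>
  define E where "E w \<alpha> = exp (2 * \<alpha> ^ 3 / 3 - 2 * w) * (4 * pi * \<alpha> ^ 3) / (\<alpha> * sqrt (8 * pi * \<alpha>))" for w \<alpha> :: real
  define F where "F = (\<lambda>\<alpha>::real. exp (\<alpha> ^ 3 / 12 - (u + v) / 2 - (u - v)\<^sup>2 / (4 * \<alpha> ^ 3)))"
  have E0: "(E w \<longlongrightarrow> 0) (at_right 0)" for w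
    unfolding E_def by real_asymp
  have F_lim: "(F \<longlongrightarrow> K_ext u v) (at_right 0)"
  proof (cases "u = v")
    case True
    have "((\<lambda>\<alpha>. exp (\<alpha> ^ 3 / 12 - v)) \<longlongrightarrow> exp (- v)) (at_right 0)" by real_asymp
    with True show ?thesis by (simp add: F_def K_ext_def)
  next
    case False
    \<comment> \<open>For distinct arguments the term with \<alpha>^3 in the denominator drives the
      exponent to minus infinity.\<close>
    then have "(u - v)\<^sup>2 > 0" by simp
    then have "(F \<longlongrightarrow> 0) (at_right 0)" unfolding F_def by real_asymp
    with False show ?thesis by (simp add: K_ext_def)
  qed
  \<comment> \<open>The logarithmic shift contributes \<open>exp (?L / 2)\<close>, which cancels
    both the factor 1/\<alpha> and the square root in the closed formula, so equality is
    exact.\<close>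
  have J1: "J \<alpha> (X u \<alpha>) (X v \<alpha>) / \<alpha> = F \<alpha>" if "\<alpha> > 0" for \<alpha>
  proof -
    let ?L = "ln (4 * pi * \<alpha> ^ 3)"
    have "4 * pi * \<alpha> ^ 3 = \<alpha>\<^sup>2 * (4 * pi * \<alpha>)" by (simp add: power3_eq_cube power2_eq_square)
    then have "sqrt (4 * pi * \<alpha> ^ 3) = \<alpha> * sqrt (4 * pi * \<alpha>)"
      using that by (simp only: real_sqrt_mult real_sqrt_abs abs_of_pos)
    moreover have "exp (?L / 2) = sqrt (4 * pi * \<alpha> ^ 3)"
      using that by (simp add: ln_sqrt[symmetric])
    ultimately have expL: "exp (?L / 2) = \<alpha> * sqrt (4 * pi * \<alpha>)" by simp
    have "\<alpha> * (X u \<alpha> + X v \<alpha>) / 2 = (u + v) / 2 - ?L / 2"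
      using that by (simp add: X_def field_simps)
    moreover have "(X u \<alpha> - X v \<alpha>)\<^sup>2 / (4 * \<alpha>) = (u - v)\<^sup>2 / (4 * \<alpha> ^ 3)"
      using that by (simp add: X_def power_divide power3_eq_cube power2_eq_square flip: diff_divide_distrib)
    ultimately have "\<alpha> ^ 3 / 12 - \<alpha> * (X u \<alpha> + X v \<alpha>) / 2 - (X u \<alpha> - X v \<alpha>)\<^sup>2 / (4 * \<alpha>)
        = (\<alpha> ^ 3 / 12 - (u + v) / 2 - (u - v)\<^sup>2 / (4 * \<alpha> ^ 3)) + ?L / 2"
      by linarith
    then have "J \<alpha> (X u \<alpha>) (X v \<alpha>) = F \<alpha> * exp (?L / 2) / sqrt (4 * pi * \<alpha>)"
      by (simp only: J_def integral_exp_mult_Ai_Ai[OF that] F_def exp_add)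
    then show ?thesis unfolding expL using that by simp
  qed
  \<comment> \<open>The doubled weight makes the shift contribute the full \<open>exp ?L\<close>,
    that is 4\<pi>\<alpha>^3, which outweighs the singular denominator.\<close>
  have J2: "J (2 * \<alpha>) (X w \<alpha>) (X w \<alpha>) / \<alpha> = E w \<alpha>" if "\<alpha> > 0" for \<alpha> w
  proof -
    let ?L = "ln (4 * pi * \<alpha> ^ 3)"
    have "(2 * \<alpha>) ^ 3 / 12 - 2 * \<alpha> * (X w \<alpha> + X w \<alpha>) / 2 - (X w \<alpha> - X w \<alpha>)\<^sup>2 / (4 * (2 * \<alpha>))
        = (2 * \<alpha> ^ 3 / 3 - 2 * w) + ?L"
      using that by (simp add: X_def field_simps)
    moreover have "exp ?L = 4 * pi * \<alpha> ^ 3" using that by simp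
    ultimately have "J (2 * \<alpha>) (X w \<alpha>) (X w \<alpha>) = exp (2 * \<alpha> ^ 3 / 3 - 2 * w) * (4 * pi * \<alpha> ^ 3) / sqrt (4 * pi * (2 * \<alpha>))"
      using that by (simp only: J_def integral_exp_mult_Ai_Ai exp_add)
    moreover have "4 * pi * (2 * \<alpha>) = 8 * pi * \<alpha>" by simp
    ultimately show ?thesis by (simp add: E_def mult_ac)
  qed
  have "((\<lambda>\<alpha>. 1 / \<alpha> * M_kernel \<alpha> (X u \<alpha>) (X v \<alpha>) - F \<alpha>) \<longlongrightarrow> 0) (at_right 0)"
  proof (rule Lim_null_comparison)
    show "((\<lambda>\<alpha>. (E u \<alpha> + E v \<alpha>) / 2) \<longlongrightarrow> 0) (at_right 0)"
      using tendsto_divide[OF tendsto_add[OF E0[of u] E0[of v]] tendsto_const[of 2]] by simp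
    have "norm (1 / \<alpha> * M_kernel \<alpha> (X u \<alpha>) (X v \<alpha>) - F \<alpha>) \<le> (E u \<alpha> + E v \<alpha>) / 2" if "\<alpha> > 0" for \<alpha>
    proof -
      have "norm (1 / \<alpha> * M_kernel \<alpha> (X u \<alpha>) (X v \<alpha>) - F \<alpha>)
          = \<bar>M_kernel \<alpha> (X u \<alpha>) (X v \<alpha>) - J \<alpha> (X u \<alpha>) (X v \<alpha>)\<bar> / \<alpha>"
        using that by (simp add: flip: J1 diff_divide_distrib)
      also have "\<dots> \<le> ((J (2 * \<alpha>) (X u \<alpha>) (X u \<alpha>) + J (2 * \<alpha>) (X v \<alpha>) (X v \<alpha>)) / 2) / \<alpha>"
        using M_kernel_approx[OF that] that unfolding J_def by (intro divide_right_mono) auto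
      also have "\<dots> = (E u \<alpha> + E v \<alpha>) / 2"
        using that by (simp flip: J2 add: add_divide_distrib)
      finally show ?thesis .
    qed
    then show "eventually (\<lambda>\<alpha>. norm (1 / \<alpha> * M_kernel \<alpha> (X u \<alpha>) (X v \<alpha>) - F \<alpha>) \<le> (E u \<alpha> + E v \<alpha>) / 2) (at_right 0)"
      using eventually_at_right_less[of 0] by (auto elim: eventually_mono)
  qed
  from tendsto_add[OF this F_lim] show ?thesis by (simp add: X_def)
qed

theorem theorem1p2:
  fixes u v :: real
  shows "((\<lambda>\<alpha>. 1 / \<alpha> * M_kernel \<alpha> (u / \<alpha> - 1 / (2 * \<alpha>) * ln (4 * pi * \<alpha> ^ 3))
                                  (v / \<alpha> - 1 / (2 * \<alpha>) * ln (4 * pi * \<alpha> ^ 3)))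
            \<longlongrightarrow> K_ext u v) (at_right 0)
       \<and> ((\<lambda>\<alpha>. M_kernel \<alpha> u v) \<longlongrightarrow> K_Airy u v) at_top"
  by (rule conjI[OF M_kernel_tendsto_K_ext M_kernel_tendsto_K_Airy])

end
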